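(* Let $n$ be a positive integer and let $T = e_1 T_1 + e_2 T_2 \in L_1^{n}\times_e L_1^{n}$ be a $\mathbb{C}_2$-nilpotent operator, where $T_1,T_2$ are $\mathbb{C}_1$-linear operators on $\mathbb{C}_1^n$. Then $T_1$ and $T_2$ are singular.
   Context: $\mathbb{C}_1$ is the field of complex numbers (imaginary unit $i_1$). The bicomplex numbers are $\mathbb{C}_2 = \{z_1 + i_2 z_2 : z_1,z_2\in\mathbb{C}_1\}$, a commutative ring with $i_1^2=i_2^2=-1$ and $i_1 i_2 = i_2 i_1$. Put $e_1 = (1+i_1 i_2)/2$ and $e_2 = (1-i_1 i_2)/2$; these satisfy $e_1^2=e_1$, $e_2^2=e_2$, $e_1e_2=0$, $e_1+e_2=1$. Every $\xi = z_1+i_2 z_2\in\mathbb{C}_2$ is written uniquely as $\xi = \xi^- e_1 + \xi^+ e_2$ with $\xi^- = z_1 - i_1 z_2$ and $\xi^+ = z_1 + i_1 z_2$ in $\mathbb{C}_1$. For $\mathbb{C}_1$-linear operators $T_1,T_2$ on $\mathbb{C}_1^n$, the $\mathbb{C}_1$-linear operator $e_1T_1+e_2T_2:\mathbb{C}_2^n\to\mathbb{C}_2^n$ is defined by $$(e_1T_1+e_2T_2)(\xi_1,\dots,\xi_n) = e_1\cdot T_1(\xi_1^-,\dots,\xi_n^-) + e_2\cdot T_2(\xi_1^+,\dots,\xi_n^+).$$ The set of all such operators is denoted $L_1^n\times_e L_1^n$. An operator $T\in L_1^n\times_e L_1^n$ is called $\mathbb{C}_2$-nilpotent if $T^k=0$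 (the $k$-fold composition) for some positive integer $k$. A linear operator on $\mathbb{C}_1^n$ is singular if it is not invertible. *)

theory Defs
  imports "HOL-Analysis.Analysis"
begin

text \<open>Bicomplex numbers: \<open>Bicomplex z1 z2\<close> stands for \<open>z1 + i2 z2\<close>.\<close>

datatype bicomplex = Bicomplex (fst_part: complex) (snd_part: complex)

lemma bicomplex_eq_iff:
  "x = y \<longleftrightarrow> fst_part x = fst_part y \<and> snd_part x = snd_part y"
  by (cases x; cases y) simp

instantiation bicomplex :: comm_ring_1
begin

definition "0 = Bicomplex 0 0"
definition "1 = Bicomplex 1 0"
definition "x + y = Bicomplex (fst_part x + fst_part y) (snd_part x + snd_part y)"
definition "- x = Bicomplex (- fst_part x) (- snd_part x)"
definition "x - y = Bicomplex (fst_part x - fst_part y) (snd_part x - snd_part y)"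
definition "x * y = Bicomplex (fst_part x * fst_part y - snd_part x * snd_part y)
                              (fst_part x * snd_part y + snd_part x * fst_part y)"

instance
  by standard
    (simp_all add: bicomplex_eq_iff zero_bicomplex_def one_bicomplex_def plus_bicomplex_def
       uminus_bicomplex_def minus_bicomplex_def times_bicomplex_def algebra_simps)

end

definition of_C1 :: "complex \<Rightarrow> bicomplex"
  where "of_C1 z = Bicomplex z 0"

definition i1 :: bicomplex where "i1 = of_C1 \<i>"
definition i2 :: bicomplex where "i2 = Bicomplex 0 1"

definition e1 :: bicomplex where "e1 = of_C1 (1/2) * (1 + i1 * i2)"
definition e2 :: bicomplex where "e2 = of_C1 (1/2) * (1 - i1 * i2)"

text \<open>The idempotent components \<open>\<xi>\<^sup>-\<close> and \<open>\<xi>\<^sup>+\<close>.\<close>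

definition minus_part :: "bicomplex \<Rightarrow> complex"
  where "minus_part \<xi> = fst_part \<xi> - \<i> * snd_part \<xi>"
definition plus_part :: "bicomplex \<Rightarrow> complex"
  where "plus_part \<xi> = fst_part \<xi> + \<i> * snd_part \<xi>"

lemmas bicomplex_defs =
  zero_bicomplex_def one_bicomplex_def plus_bicomplex_def uminus_bicomplex_def
  minus_bicomplex_def times_bicomplex_def of_C1_def i1_def i2_def e1_def e2_def
  minus_part_def plus_part_def

lemma Bicomplex_conv: "Bicomplex z1 z2 = of_C1 z1 + i2 * of_C1 z2"
  by (simp add: bicomplex_defs)

lemma imaginary_units: "i1 * i1 = - 1" "i2 * i2 = - 1"
  by (simp_all add: bicomplex_defs)

lemma idempotents: "e1 * e1 = e1" "e2 * e2 = e2" "e1 * e2 = 0" "e1 + e2 = 1"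
  by (simp_all add: bicomplex_defs field_simps)

lemma idempotent_decomposition:
  "\<xi> = of_C1 (minus_part \<xi>) * e1 + of_C1 (plus_part \<xi>) * e2"
  by (cases \<xi>) (simp add: bicomplex_defs field_simps)

lemma idempotent_decomposition_unique:
  assumes "\<xi> = of_C1 a * e1 + of_C1 b * e2"
  shows "a = minus_part \<xi>" "b = plus_part \<xi>"
  using assms by (simp_all add: bicomplex_defs field_simps)

text \<open>\<open>(*s)\<close> is the complex (resp. bicomplex) scalar multiplication on vectors, whereas the
  unqualified \<open>linear\<close> of the library would only mean linearity over the reals.\<close>

definition L1 :: "(complex ^ 'n \<Rightarrow> complex ^ 'n) set"
  where "L1 = {A. Vector_Spaces.linear (*s) (*s) A}"

definition e_sum ::
  "(complex ^ 'n \<Rightarrow> complex ^ 'n) \<Rightarrow> (complex ^ 'n \<Rightarrow> complex ^ 'n) \<Rightarrow>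
   bicomplex ^ 'n \<Rightarrow> bicomplex ^ 'n"
  where "e_sum T1 T2 \<xi> =
    e1 *s (\<chi> j. of_C1 (T1 (\<chi> i. minus_part (\<xi> $ i)) $ j)) +
    e2 *s (\<chi> j. of_C1 (T2 (\<chi> i. plus_part (\<xi> $ i)) $ j))"

definition L1_e_L1 :: "(bicomplex ^ 'n \<Rightarrow> bicomplex ^ 'n) set"
  where "L1_e_L1 = {e_sum T1 T2 | T1 T2. T1 \<in> L1 \<and> T2 \<in> L1}"

definition C2_nilpotent :: "(bicomplex ^ 'n \<Rightarrow> bicomplex ^ 'n) \<Rightarrow> bool"
  where "C2_nilpotent T \<longleftrightarrow> T \<in> L1_e_L1 \<and> (\<exists>k>0. T ^^ k = (\<lambda>_. 0))"

definition invertible_op :: "(complex ^ 'n \<Rightarrow> complex ^ 'n) \<Rightarrow> bool"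
  where "invertible_op A \<longleftrightarrow> (\<exists>B\<in>L1. A \<circ> B = id \<and> B \<circ> A = id)"

definition singular_op :: "(complex ^ 'n \<Rightarrow> complex ^ 'n) \<Rightarrow> bool"
  where "singular_op A \<longleftrightarrow> \<not> invertible_op A"

end

theory Submission imports Defs begin

text \<open>The projections \<open>\<xi> \<mapsto> \<xi>\<^sup>-\<close> and \<open>\<xi> \<mapsto> \<xi>\<^sup>+\<close> are surjective and semiconjugate \<open>T\<close> to \<open>T1\<close> and
  \<open>T2\<close>. So \<open>T ^^ k = 0\<close> makes \<open>T1 ^^ k\<close> and \<open>T2 ^^ k\<close> constant, whereas the powers of an
  invertible operator are surjective onto a space with more than one point.\<close>

lemma not_surj_if_semiconj_const_power:
  fixes A :: "complex ^ 'n \<Rightarrow> complex ^ 'n"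
  assumes "surj P" and semiconj: "\<And>x. P (T x) = A (P x)" and const: "T ^^ k = (\<lambda>_. c)"
  shows "\<not> surj A"
proof
  assume "surj A"
  have "P ((T ^^ k) x) = (A ^^ k) (P x)" for x
    by (induction k) (simp_all add: semiconj)
  with const \<open>surj P\<close> have "(A ^^ k) y = P c" for y
    by (metis surjD)
  moreover have "surj (A ^^ k)"
    using \<open>surj A\<close> by (rule surj_fn)
  ultimately have "y = P c" for y
    by (metis surjD)
  \<comment> \<open>The all-ones vector \<open>1\<close> differs from \<open>0\<close> since an
    index type is never empty: the dimension is positive.\<close>
  then have "(0 :: complex ^ 'n) = 1"
    by metis
  then show False
    by simp
qed

lemma invertible_op_imp_surj: "invertible_op A \<Longrightarrow> surj A"
  unfolding invertible_op_def by (metis comp_apply id_apply surjI)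

text \<open>\<open>minus_part\<close> is multiplicative and sends \<open>e1\<close> to 1 and
  \<open>e2\<close> to 0, so only the \<open>T1\<close> summand survives; \<open>plus_part\<close>
  swaps the roles.\<close>

lemma minus_part_e_sum:
  "(\<chi> i. minus_part (e_sum T1 T2 \<xi> $ i)) = T1 (\<chi> i. minus_part (\<xi> $ i))"
  by (simp add: vec_eq_iff e_sum_def bicomplex_defs field_simps)

lemma plus_part_e_sum:
  "(\<chi> i. plus_part (e_sum T1 T2 \<xi> $ i)) = T2 (\<chi> i. plus_part (\<xi> $ i))"
  by (simp add: vec_eq_iff e_sum_def bicomplex_defs field_simps)

text \<open>Both idempotent components of a complex number \<open>z\<close> are \<open>z\<close>
  itself, so \<open>of_C1\<close> taken entrywise is a right inverse of either projection.\<close>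

lemma surj_minus_part: "surj (\<lambda>\<xi> :: bicomplex ^ 'n. \<chi> i. minus_part (\<xi> $ i))"
  by (rule surjI[where f = "\<lambda>v. \<chi> i. of_C1 (v $ i)"]) (simp add: vec_eq_iff bicomplex_defs)

lemma surj_plus_part: "surj (\<lambda>\<xi> :: bicomplex ^ 'n. \<chi> i. plus_part (\<xi> $ i))"
  by (rule surjI[where f = "\<lambda>v. \<chi> i. of_C1 (v $ i)"]) (simp add: vec_eq_iff bicomplex_defs)

theorem theorem3p5:
  fixes T1 T2 :: "complex ^ 'n \<Rightarrow> complex ^ 'n"
    and T :: "bicomplex ^ 'n \<Rightarrow> bicomplex ^ 'n"
  assumes "T1 \<in> L1" and "T2 \<in> L1"
    and "T = e_sum T1 T2"
    and "C2_nilpotent T"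
  shows "singular_op T1 \<and> singular_op T2"
proof -
  obtain k where k: "e_sum T1 T2 ^^ k = (\<lambda>_. 0)"
    using assms(3,4) unfolding C2_nilpotent_def by blast
  have "\<not> surj T1"
    using surj_minus_part minus_part_e_sum k by (rule not_surj_if_semiconj_const_power)
  moreover have "\<not> surj T2"
    using surj_plus_part plus_part_e_sum k by (rule not_surj_if_semiconj_const_power)
  ultimately show ?thesis
    unfolding singular_op_def using invertible_op_imp_surj by blast
qed

end
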